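(* For every integer $n\ge5$, the proportion of elements of $\mathrm{S}_n$ that are pre-$p$-cycles for some prime $p$ with $2\le p\le n-3$ is at least $1/19$.
   Context: $\mathrm{S}_n$ denotes the symmetric group of degree $n$. A $k$-cycle (for $k>1$) is a permutation having exactly one cycle of length greater than $1$ in its disjoint cycle decomposition, that cycle having length $k$. A permutation $g\in\mathrm{S}_n$ is a pre-$k$-cycle (for $k>1$) if some power of $g$ is a $k$-cycle. The proportion of elements of $\mathrm{S}_n$ with a property is the number of such elements divided by $n!$. *)

theory Defs
  imports
    Complex_Main
    "HOL-Combinatorics.Orbits"
    "HOL-Algebra.Sym_Groups"
    "HOL-Computational_Algebra.Primes"
begin

text \<open>
  The cycles of the disjoint cycle decomposition of a permutation of \<open>{1..n}\<close>, fixed points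
  included, are represented by their underlying sets, which are its orbits; the length of a cycle
  is the cardinality of the orbit.
\<close>

definition perm_cycles :: "nat \<Rightarrow> (nat \<Rightarrow> nat) \<Rightarrow> nat set set" where
  "perm_cycles n g = (\<lambda>x. orbit g x) ` {1..n}"

definition is_k_cycle :: "nat \<Rightarrow> nat \<Rightarrow> (nat \<Rightarrow> nat) \<Rightarrow> bool" where
  "is_k_cycle n k g \<longleftrightarrow>
     1 < k \<and> g \<in> carrier (sym_group n) \<and>
     (\<exists>C. {D \<in> perm_cycles n g. 1 < card D} = {C} \<and> card C = k)"

text \<open>
  Natural exponents suffice for ``some power'', since every element of the group has finite order.
\<close>

definition is_pre_k_cycle :: "nat \<Rightarrow> nat \<Rightarrow> (nat \<Rightarrow> nat) \<Rightarrow> bool" where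
  "is_pre_k_cycle n k g \<longleftrightarrow>
     1 < k \<and> g \<in> carrier (sym_group n) \<and> (\<exists>m::nat. is_k_cycle n k (g [^]\<^bsub>sym_group n\<^esub> m))"

definition sym_proportion :: "nat \<Rightarrow> ((nat \<Rightarrow> nat) \<Rightarrow> bool) \<Rightarrow> real" where
  "sym_proportion n P = real (card {g \<in> carrier (sym_group n). P g}) / fact n"

end

theory Submission
  imports Defs "HOL-Number_Theory.Cong" "HOL-Analysis.Harmonic_Numbers"
begin

text \<open>
  For a prime \<open>p\<close>, let \<open>A p\<close> be the set of permutations of \<open>n\<close> points with exactly one cycle of length
  divisible by \<open>p\<close>, that cycle having length \<open>p\<close>. Raising an element of \<open>A p\<close> to the product of its other
  cycle lengths leaves a \<open>p\<close>-cycle (\<open>unique_cycle_perms_pre_cycle\<close>), so it suffices to bound the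
  proportion of the union of the sets \<open>A p\<close> over suitable primes \<open>p \<le> n - 3\<close>.

  Choosing the cycle first, the proportion of \<open>A p\<close> is \<open>1 / p\<close> times the probability that a permutation
  of \<open>n - p\<close> points has no cycle length divisible by \<open>p\<close> (\<open>card_unique_cycle_perms\<close>). That probability is
  the product of the factors \<open>1 - 1 / (i * p)\<close> over \<open>i = 1..(n - p) div p\<close> (\<open>card_free_perms\<close>), which
  decays only like \<open>(n / p) powr (- 1 / p)\<close> (\<open>free_prob_power_ge\<close>). The single prime \<open>p = 2\<close> therefore
  suffices for \<open>n = 5\<close>, and \<open>p = 3\<close> for \<open>6 \<le> n \<le> 230\<close>.

  For \<open>n \<ge> 229\<close>, primes \<open>p \<ge> ln n\<close> are used. For them the probability above is at least \<open>1 / exp 1\<close>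
  (\<open>free_prob_ge_inverse_exp\<close>), while \<open>A p\<close> and \<open>A q\<close> meet in a proportion of at most \<open>1 / (p * q)\<close>
  (\<open>card_two_cycle_lengths_le\<close>). By Bonferroni (\<open>card_Union_ge\<close>), primes whose reciprocals have the sum
  \<open>t\<close> yield the proportion \<open>t / exp 1 - t\<^sup>2 / 2\<close>, which exceeds \<open>1 / 19\<close> for \<open>t\<close> slightly above \<open>1 / 5\<close>.
  That there are enough primes between \<open>ln n\<close> and \<open>n - 3\<close> to reach \<open>1 / 5\<close> follows from the prime
  factorization of the factorial (\<open>sum_inverse_primes_ge\<close>), as the primes below \<open>ln n\<close> account for too
  small a part of it.
\<close>

section \<open>Splitting off a cycle\<close>

text \<open>
  The part of a permutation outside one of its cycles is carried as a separate condition \<open>B\<close>: all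
  counts below split off a cycle \<open>C\<close>, sum over the possible sets \<open>C\<close>, and recurse into \<open>S - C\<close>.
\<close>

definition with_cycle :: "'a set \<Rightarrow> 'a set \<Rightarrow> ('a \<Rightarrow> 'a) set \<Rightarrow> ('a \<Rightarrow> 'a) set" where
  "with_cycle S C B = {g. g permutes S \<and> cyclic_on g C \<and> perm_restrict g (S - C) \<in> B}"

lemma orbit_perm_restrict:
  assumes "g permutes S" "cyclic_on g C" "x \<in> S - C"
  shows "orbit (perm_restrict g (S - C)) x = orbit g x"
proof (rule orbit_cong0[OF assms(3)])
  have p: "perm_restrict g (S - C) permutes (S - C)"
    using assms by (intro perm_restrict_diff_cyclic)
  show "perm_restrict g (S - C) \<in> S - C \<rightarrow> S - C"
    using permutes_in_image[OF p] by blast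
qed (simp add: perm_restrict_simps)

text \<open>
  A permutation with cycle \<open>C\<close> is the product of its restrictions to \<open>C\<close> and to the complement, and
  these two factors can be chosen independently.
\<close>

lemma card_with_cycle_eq_times:
  assumes "C \<subseteq> S" "B \<subseteq> {b. b permutes (S - C)}"
  shows "card (with_cycle S C B) = card {a. a permutes C \<and> cyclic_on a C} * card B"
proof -
  let ?A = "{a. a permutes C \<and> cyclic_on a C}"
  have "bij_betw (\<lambda>(a, b). a \<circ> b) (?A \<times> B) (with_cycle S C B)"
  proof (rule bij_betw_byWitness[where f' = "\<lambda>g. (perm_restrict g C, perm_restrict g (S - C))"])
    show "\<forall>x\<in>?A \<times> B. (perm_restrict ((\<lambda>(a, b). a \<circ> b) x) C,
        perm_restrict ((\<lambda>(a, b). a \<circ> b) x) (S - C)) = x"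
    proof
      fix x assume "x \<in> ?A \<times> B"
      then obtain a b where x: "x = (a, b)" and a: "a permutes C" and b: "b \<in> B" by auto
      from b assms have b': "b permutes (S - C)" by auto
      have "perm_restrict (a \<circ> b) C = a"
        using permutes_not_in[OF b'] permutes_not_in[OF a] by (auto simp: perm_restrict_def fun_eq_iff)
      moreover have "perm_restrict (a \<circ> b) (S - C) = b"
        using permutes_not_in[OF b'] permutes_not_in[OF a] permutes_in_image[OF b']
        by (auto simp: perm_restrict_def fun_eq_iff)
      ultimately show "(perm_restrict ((\<lambda>(a, b). a \<circ> b) x) C,
        perm_restrict ((\<lambda>(a, b). a \<circ> b) x) (S - C)) = x" by (simp add: x)
    qed
    show "\<forall>g\<in>with_cycle S C B. (\<lambda>(a, b). a \<circ> b) (perm_restrict g C, perm_restrict g (S - C)) = g"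
    proof
      fix g assume "g \<in> with_cycle S C B"
      then have g: "g permutes S" "cyclic_on g C" by (auto simp: with_cycle_def)
      have "perm_restrict g (S - C) permutes (S - C)"
        using g by (intro perm_restrict_diff_cyclic)
      from permutes_in_image[OF this] have "g x \<in> S - C" if "x \<in> S - C" for x
        using that by (metis perm_restrict_simps(1))
      then show "(\<lambda>(a, b). a \<circ> b) (perm_restrict g C, perm_restrict g (S - C)) = g"
        using permutes_not_in[OF g(1)] by (auto simp: perm_restrict_def fun_eq_iff)
    qed
    show "(\<lambda>(a, b). a \<circ> b) ` (?A \<times> B) \<subseteq> with_cycle S C B"
    proof (clarify)
      fix a b assume a: "a permutes C" "cyclic_on a C" and b: "b \<in> B"
      from b assms have b': "b permutes (S - C)" by auto
      have "a \<circ> b permutes S"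
        using assms a(1) b' by (intro permutes_compose) (auto intro: permutes_subset)
      moreover have "cyclic_on (a \<circ> b) C"
        using a b' by (intro permutes_comp_preserves_cyclic1[where A = C and B = "S - C"]) auto
      moreover have "perm_restrict (a \<circ> b) (S - C) = b"
        using permutes_not_in[OF b'] permutes_not_in[OF a(1)] permutes_in_image[OF b']
        by (auto simp: perm_restrict_def fun_eq_iff)
      ultimately show "a \<circ> b \<in> with_cycle S C B" using b by (simp add: with_cycle_def)
    qed
    show "(\<lambda>g. (perm_restrict g C, perm_restrict g (S - C))) ` with_cycle S C B \<subseteq> ?A \<times> B"
    proof (rule image_subsetI)
      fix g assume "g \<in> with_cycle S C B"
      then have g: "g permutes S" "cyclic_on g C" "perm_restrict g (S - C) \<in> B"
        by (auto simp: with_cycle_def)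
      have inj: "inj_on g C" using g(1) by (metis permutes_inj inj_on_subset subset_UNIV)
      have "g ` C \<subseteq> C" using g(2) cyclic_on_inI by fast
      then have "g ` C = C" using inj finite_cyclic_on[OF g(2)] by (simp add: endo_inj_surj)
      then have "bij_betw g C C" using inj by (simp add: bij_betw_def)
      then have "bij_betw (perm_restrict g C) C C"
        by (subst bij_betw_cong[of _ _ g]) (auto simp: perm_restrict_simps)
      then have "perm_restrict g C permutes C"
        by (intro bij_imp_permutes) (auto simp: perm_restrict_simps)
      then show "(perm_restrict g C, perm_restrict g (S - C)) \<in> ?A \<times> B"
        using g by (simp add: cyclic_on_perm_restrict)
    qed
  qed
  from bij_betw_same_card[OF this] show ?thesis by (simp add: card_cartesian_product)
qed

lemma sum_card_containing:
  fixes F :: "nat \<Rightarrow> 'b :: comm_semiring_1"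
  assumes "finite S" "x \<in> S"
  shows "(\<Sum>D | D \<subseteq> S \<and> x \<in> D. F (card D)) =
         (\<Sum>j<card S. of_nat ((card S - 1) choose j) * F (Suc j))"
proof -
  define A where "A = S - {x}"
  have A: "finite A" "x \<notin> A" "S = insert x A" "card S = Suc (card A)"
    using assms card_Suc_Diff1[OF assms] by (auto simp: A_def)
  have "{D. D \<subseteq> S \<and> x \<in> D} = insert x ` Pow A"
  proof (intro equalityI subsetI)
    fix D assume "D \<in> {D. D \<subseteq> S \<and> x \<in> D}"
    then have "D = insert x (D - {x})" "D - {x} \<in> Pow A" using A by auto
    then show "D \<in> insert x ` Pow A" by blast
  qed (use A in auto)
  moreover have "inj_on (insert x) (Pow A)" using A(2) by (auto simp: inj_on_def)
  ultimately have "(\<Sum>D | D \<subseteq> S \<and> x \<in> D. F (card D)) = (\<Sum>D\<in>Pow A. F (card (insert x D)))"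
    by (simp add: sum.reindex)
  also have "\<dots> = (\<Sum>D\<in>Pow A. F (Suc (card D)))"
  proof (rule sum.cong)
    fix D assume "D \<in> Pow A"
    then have "finite D" "x \<notin> D" using A by (auto intro: finite_subset)
    then show "F (card (insert x D)) = F (Suc (card D))" by simp
  qed simp
  also have "\<dots> = (\<Sum>j\<in>{..card A}. \<Sum>D | D \<in> Pow A \<and> card D = j. F (Suc (card D)))"
    using A(1) by (intro sum.group[symmetric]) (auto intro: card_mono)
  also have "\<dots> = (\<Sum>j\<in>{..card A}. of_nat (card A choose j) * F (Suc j))"
    using A(1) by (intro sum.cong) (auto simp: n_subsets)
  finally show ?thesis using A(4) by (simp add: lessThan_Suc_atMost)
qed

text \<open>
  The cycle through a given point \<open>x\<close> is unique, so it partitions any set of permutations. The class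
  of a set \<open>D\<close> is allowed to be described by any \<open>B D\<close>, in particular by the empty set when \<open>D\<close> is an
  excluded cycle.
\<close>

lemma card_by_cycle_through:
  assumes "finite S" "x \<in> S"
  assumes "\<And>g. g \<in> X \<Longrightarrow> g permutes S"
  assumes "\<And>D. D \<subseteq> S \<Longrightarrow> x \<in> D \<Longrightarrow> {g \<in> X. cyclic_on g D} = with_cycle S D (B D)"
  shows "card X = (\<Sum>D | D \<subseteq> S \<and> x \<in> D. card (with_cycle S D (B D)))"
proof -
  have fin: "finite X"
    by (rule finite_subset[OF _ finite_permutations[OF assms(1)]]) (use assms(3) in auto)
  have "X = (\<Union>D\<in>{D. D \<subseteq> S \<and> x \<in> D}. {g \<in> X. cyclic_on g D})"
  proof (intro equalityI subsetI)
    fix g assume g: "g \<in> X"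
    note perm = assms(3)[OF g]
    have "orbit g x \<subseteq> S" using perm assms(2) by (rule permutes_orbit_subset)
    moreover have "cyclic_on g (orbit g x)" using perm assms(1) by (rule cyclic_on_orbit)
    moreover have "x \<in> orbit g x"
      using perm assms(1) permutation_self_in_orbit permutation_permutes by metis
    ultimately show "g \<in> (\<Union>D\<in>{D. D \<subseteq> S \<and> x \<in> D}. {g \<in> X. cyclic_on g D})" using g by auto
  qed auto
  also have "card \<dots> = (\<Sum>D | D \<subseteq> S \<and> x \<in> D. card {g \<in> X. cyclic_on g D})"
    using assms(1) fin
    by (intro card_UN_disjoint) (auto dest: orbit_cyclic_eq3)
  also have "\<dots> = (\<Sum>D | D \<subseteq> S \<and> x \<in> D. card (with_cycle S D (B D)))"
    using assms(4) by (intro sum.cong) auto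
  finally show ?thesis .
qed

text \<open>
  This follows from the partition by the cycle through \<open>x\<close> alone: in an induction on \<open>card C = Suc m\<close>,
  each of the \<open>m\<close> possible lengths below \<open>Suc m\<close> accounts for \<open>fact m\<close> of the \<open>fact (Suc m)\<close>
  permutations, so exactly \<open>fact m\<close> of them are left for a single cycle.
\<close>

lemma card_cyclic_permutations:
  assumes "finite C" "C \<noteq> {}"
  shows "card {a. a permutes C \<and> cyclic_on a C} = fact (card C - 1)"
  using assms
proof (induction "card C" arbitrary: C rule: less_induct)
  case less
  let ?c = "\<lambda>D. card {a. a permutes D \<and> cyclic_on a D}"
  obtain x where x: "x \<in> C" using less.prems by blast
  obtain m where m: "card C = Suc m" using less.prems by (metis card_eq_0_iff not0_implies_Suc)
  let ?P = "{D. D \<subseteq> C \<and> x \<in> D}"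
  let ?F = "\<lambda>k. fact (k - 1) * fact (Suc m - k) :: nat"
  have fin: "finite ?P" using less.prems by simp
  have "{g \<in> {g. g permutes C}. cyclic_on g D} = with_cycle C D {b. b permutes (C - D)}" for D
    by (auto simp: with_cycle_def perm_restrict_diff_cyclic)
  then have "fact (Suc m) = (\<Sum>D\<in>?P. card (with_cycle C D {b. b permutes (C - D)}))"
    using card_by_cycle_through[OF less.prems(1) x, of "{g. g permutes C}" "\<lambda>D. {b. b permutes (C - D)}"]
      card_permutations[OF m less.prems(1)] by simp
  also have "\<dots> = (\<Sum>D\<in>?P. ?c D * fact (Suc m - card D))"
  proof (rule sum.cong)
    fix D assume D: "D \<in> ?P"
    then have "finite (C - D)" "card (C - D) = Suc m - card D"
      using less.prems m by (auto simp: card_Diff_subset finite_subset)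
    then have "card {b. b permutes (C - D)} = fact (Suc m - card D)"
      by (simp add: card_permutations)
    with D show "card (with_cycle C D {b. b permutes (C - D)}) = ?c D * fact (Suc m - card D)"
      by (subst card_with_cycle_eq_times) auto
  qed simp
  also have "\<dots> = ?c C + (\<Sum>D\<in>?P - {C}. ?c D * fact (Suc m - card D))"
    using fin x m by (subst sum.remove[of _ C]) auto
  also have "(\<Sum>D\<in>?P - {C}. ?c D * fact (Suc m - card D)) = (\<Sum>D\<in>?P - {C}. ?F (card D))"
  proof (rule sum.cong)
    fix D assume D: "D \<in> ?P - {C}"
    then have "D \<subset> C" by auto
    then have "card D < card C" "finite D" using less.prems by (auto intro: psubset_card_mono finite_subset)
    with D less.hyps show "?c D * fact (Suc m - card D) = ?F (card D)" by auto
  qed simp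
  \<comment> \<open>Adding the term that the induction hypothesis predicts for \<open>C\<close> itself completes the sum over all \<open>D\<close>.\<close>
  finally have "fact (Suc m) + ?F (card C) = ?c C + (\<Sum>D\<in>?P. ?F (card D))"
    using fin x by (subst sum.remove[of ?P C]) auto
  also have "(\<Sum>D\<in>?P. ?F (card D)) = (\<Sum>j<Suc m. of_nat (m choose j) * ?F (Suc j))"
    using sum_card_containing[OF less.prems(1) x, of ?F] m by simp
  also have "\<dots> = (\<Sum>j<Suc m. fact m)"
  proof (rule sum.cong)
    fix j assume "j \<in> {..<Suc m}"
    then have "fact j * fact (m - j) * (m choose j) = fact m"
      by (intro binomial_fact_lemma) auto
    then show "of_nat (m choose j) * ?F (Suc j) = fact m" by (simp add: mult_ac)
  qed simp
  finally show ?case using m by simp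
qed

lemma card_with_cycle:
  assumes "finite S" "C \<subseteq> S" "C \<noteq> {}" "B \<subseteq> {b. b permutes (S - C)}"
  shows "card (with_cycle S C B) = fact (card C - 1) * card B"
  using assms by (simp add: card_with_cycle_eq_times card_cyclic_permutations finite_subset)

section \<open>Permutations without cycle lengths divisible by a number\<close>

text \<open>
  The Erdos-Turan formula for the probability that a random permutation of \<open>m\<close> points has no cycle of
  length divisible by \<open>p\<close>; this meaning is established in \<open>card_free_perms\<close>.
\<close>

definition free_prob :: "nat \<Rightarrow> nat \<Rightarrow> real" where
  "free_prob p m = (\<Prod>i = 1..m div p. 1 - 1 / real (i * p))"

lemma free_prob_add:
  assumes "p > 0" "r < p"
  shows "free_prob p (q * p + r) = free_prob p (q * p)"
  using assms by (simp add: free_prob_def)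

lemma free_prob_Suc:
  assumes "p > 0"
  shows "real (Suc q * p) * free_prob p (Suc q * p) = (real (Suc q * p) - 1) * free_prob p (q * p)"
proof -
  have "real (Suc q * p) > 0" using assms by (simp only: of_nat_0_less_iff) simp
  moreover have "free_prob p (Suc q * p) = free_prob p (q * p) * (1 - 1 / real (Suc q * p))"
    using assms by (simp add: free_prob_def del: mult_Suc)
  ultimately show ?thesis by (simp add: field_simps del: mult_Suc)
qed

text \<open>
  The recurrence obtained by conditioning on the length \<open>Suc j\<close> of the cycle through a given point,
  which is uniformly distributed. Lowering \<open>m\<close> by \<open>p\<close> removes the first \<open>p\<close> summands and keeps the
  others, and the removed ones only see the two values that \<open>free_prob p\<close> takes on \<open>{m - p..m}\<close>.
\<close>

lemma free_prob_recurrence: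
  assumes p: "p > 0"
  shows "(\<Sum>j<m. if p dvd Suc j then 0 else free_prob p (m - 1 - j)) = real m * free_prob p m"
proof (induction m rule: less_induct)
  case (less m)
  let ?f = "\<lambda>m j. if p dvd Suc j then 0 else free_prob p (m - 1 - j)"
  show ?case
  proof (cases "m < p")
    case True
    have "?f m j = 1" if "j < m" for j
      using that True by (auto simp: free_prob_def dest: dvd_imp_le)
    moreover have "free_prob p m = 1" using True by (simp add: free_prob_def)
    ultimately show ?thesis by simp
  next
    case False
    define q r where "q = m div p - 1" and "r = m mod p"
    have r: "r < p" using p by (simp add: r_def)
    have "m div p > 0" using False p by (simp add: div_greater_zero_iff)
    then have "m div p = Suc q" by (simp add: q_def)
    then have m: "m = Suc q * p + r" using div_mult_mod_eq[of m p] by (simp add: r_def)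
    have split: "{..<m} = {..<p} \<union> (\<lambda>j. j + p) ` {..<m - p}"
    proof (intro equalityI subsetI)
      fix j assume "j \<in> {..<m}"
      then show "j \<in> {..<p} \<union> (\<lambda>j. j + p) ` {..<m - p}"
        using False by (cases "j < p") (auto intro!: image_eqI[of _ _ "j - p"])
    qed (use False in auto)
    have "(\<Sum>j<m. ?f m j) = (\<Sum>j<p. ?f m j) + (\<Sum>j<m - p. ?f m (j + p))"
      unfolding split by (subst sum.union_disjoint) (auto simp: sum.reindex)
    also have "(\<Sum>j<m - p. ?f m (j + p)) = (\<Sum>j<m - p. ?f (m - p) j)"
    proof (rule sum.cong)
      fix j
      have "p dvd Suc (j + p) \<longleftrightarrow> p dvd Suc j"
        using dvd_add_left_iff[of p p "Suc j"] by (simp del: dvd_add_left_iff)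
      moreover have "m - 1 - (j + p) = m - p - 1 - j" by simp
      ultimately show "?f m (j + p) = ?f (m - p) j" by presburger
    qed simp
    also have "\<dots> = real (m - p) * free_prob p (m - p)"
      using False p by (intro less.IH) auto
    also have "m - p = q * p + r" using m by simp
    also have "free_prob p \<dots> = free_prob p (q * p)" using p r by (rule free_prob_add)
    also have "(\<Sum>j<p. ?f m j) = (\<Sum>j<p - 1. free_prob p (m - 1 - j))"
    proof -
      have "{..<p} = insert (p - 1) {..<p - 1}" using p by auto
      then have "(\<Sum>j<p. ?f m j) = (\<Sum>j<p - 1. ?f m j)" using p by simp
      also have "\<dots> = (\<Sum>j<p - 1. free_prob p (m - 1 - j))"
        by (intro sum.cong) (auto dest: dvd_imp_le)
      finally show ?thesis .
    qed
    also have "\<dots> = (\<Sum>j<p - 1. if j < r then free_prob p (Suc q * p) else free_prob p (q * p))"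
    proof (rule sum.cong)
      fix j assume j: "j \<in> {..<p - 1}"
      show "free_prob p (m - 1 - j) =
        (if j < r then free_prob p (Suc q * p) else free_prob p (q * p))"
      proof (cases "j < r")
        case True
        then have "m - 1 - j = Suc q * p + (r - 1 - j)" using m by simp
        moreover have "r - 1 - j < p" using r by simp
        ultimately show ?thesis using True p free_prob_add by metis
      next
        case False
        then have "m - 1 - j = q * p + (p + r - 1 - j)" using m j by simp
        moreover have "p + r - 1 - j < p" using False j by auto
        ultimately show ?thesis using False p free_prob_add by metis
      qed
    qed simp
    also have "\<dots> = real r * free_prob p (Suc q * p) + real (p - 1 - r) * free_prob p (q * p)"
    proof -
      have "{..<p - 1} \<inter> {j. j < r} = {..<r}" using r by auto
      moreover have "{..<p - 1} \<inter> - {j. j < r} = {r..<p - 1}" by auto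
      ultimately show ?thesis by (simp add: sum.If_cases)
    qed
    also have "\<dots> + real (q * p + r) * free_prob p (q * p) =
        real r * free_prob p (Suc q * p) + (real (Suc q * p) - 1) * free_prob p (q * p)"
      using r p by (simp add: of_nat_diff algebra_simps)
    also have "\<dots> = real m * free_prob p (Suc q * p)"
      by (subst free_prob_Suc[OF p, symmetric]) (simp only: m of_nat_add distrib_right add.commute)
    also have "free_prob p (Suc q * p) = free_prob p m"
      unfolding m using p r by (rule free_prob_add[symmetric])
    finally show ?thesis .
  qed
qed

definition free_perms :: "nat \<Rightarrow> 'a set \<Rightarrow> ('a \<Rightarrow> 'a) set" where
  "free_perms p S = {g. g permutes S \<and> (\<forall>x\<in>S. \<not> p dvd card (orbit g x))}"

lemma with_cycle_free_perms_iff: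
  "g \<in> with_cycle S C (free_perms p (S - C)) \<longleftrightarrow>
     g permutes S \<and> cyclic_on g C \<and> (\<forall>x\<in>S - C. \<not> p dvd card (orbit g x))"
  by (auto simp: with_cycle_def free_perms_def perm_restrict_diff_cyclic orbit_perm_restrict)

text \<open>
  Splitting off the cycle through a point turns the count for \<open>S\<close> into the recurrence satisfied by
  \<open>free_prob\<close>.
\<close>

lemma card_free_perms:
  assumes "finite S" "p > 0"
  shows "card (free_perms p S) = fact (card S) * free_prob p (card S)"
  using assms(1)
proof (induction "card S" arbitrary: S rule: less_induct)
  case less
  show ?case
  proof (cases "S = {}")
    case True
    then have "free_perms p S = {id}" by (auto simp: free_perms_def)
    then show ?thesis using True by (simp add: free_prob_def)
  next
    case False
    then obtain x where x: "x \<in> S" by blast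
    define m where "m = card S"
    have m: "m > 0" using False less.prems by (simp add: m_def card_gt_0_iff)
    define B where "B D = (if p dvd card D then {} else free_perms p (S - D))" for D
    let ?F = "\<lambda>k. if p dvd k then 0 else fact (k - 1) * (fact (m - k) * free_prob p (m - k))"
    have "{g \<in> free_perms p S. cyclic_on g D} = with_cycle S D (B D)" if D: "D \<subseteq> S" "x \<in> D" for D
    proof (cases "p dvd card D")
      case True
      then show ?thesis
        using D x orbit_cyclic_eq3 by (fastforce simp: free_perms_def with_cycle_def B_def)
    next
      case notdvd: False
      have "(\<forall>y\<in>S. \<not> p dvd card (orbit g y)) \<longleftrightarrow> (\<forall>y\<in>S - D. \<not> p dvd card (orbit g y))"
        if "cyclic_on g D" for g
        using notdvd orbit_cyclic_eq3[OF that] by auto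
      then have "g \<in> {g \<in> free_perms p S. cyclic_on g D} \<longleftrightarrow>
          g \<in> with_cycle S D (free_perms p (S - D))" for g
        unfolding with_cycle_free_perms_iff by (auto simp: free_perms_def)
      then show ?thesis using notdvd by (auto simp: B_def)
    qed
    then have "card (free_perms p S) = (\<Sum>D | D \<subseteq> S \<and> x \<in> D. card (with_cycle S D (B D)))"
      using less.prems x by (intro card_by_cycle_through) (auto simp: free_perms_def)
    also have "real \<dots> = (\<Sum>D | D \<subseteq> S \<and> x \<in> D. ?F (card D))"
      unfolding of_nat_sum
    proof (rule sum.cong)
      fix D assume D: "D \<in> {D. D \<subseteq> S \<and> x \<in> D}"
      then have fin: "finite D" using less.prems finite_subset by auto
      have "card D > 0" using D fin by (auto simp: card_gt_0_iff)
      moreover have "card (S - D) = m - card D" using D fin by (simp add: m_def card_Diff_subset)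
      ultimately have "card (free_perms p (S - D)) = fact (m - card D) * free_prob p (m - card D)"
        using less.hyps[of "S - D"] less.prems m m_def by simp
      moreover have "card (with_cycle S D (B D)) = fact (card D - 1) * card (B D)"
        using D less.prems by (intro card_with_cycle) (auto simp: B_def free_perms_def)
      ultimately show "real (card (with_cycle S D (B D))) = ?F (card D)"
        by (simp add: B_def)
    qed simp
    also have "\<dots> = (\<Sum>j<m. real ((m - 1) choose j) * ?F (Suc j))"
      using sum_card_containing[OF less.prems x, of ?F] by (simp add: m_def)
    also have "\<dots> = (\<Sum>j<m. fact (m - 1) * (if p dvd Suc j then 0 else free_prob p (m - 1 - j)))"
    proof (rule sum.cong)
      fix j assume "j \<in> {..<m}"
      then have "fact j * fact (m - 1 - j) * ((m - 1) choose j) = fact (m - 1)"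
        by (intro binomial_fact_lemma) auto
      then have "real (fact j * fact (m - 1 - j) * ((m - 1) choose j)) = fact (m - 1)"
        by (simp only: of_nat_fact)
      then show "real ((m - 1) choose j) * ?F (Suc j) =
          fact (m - 1) * (if p dvd Suc j then 0 else free_prob p (m - 1 - j))"
        by (simp add: mult_ac)
    qed simp
    also have "\<dots> = fact (m - 1) * (real m * free_prob p m)"
      by (simp only: sum_distrib_left[symmetric] free_prob_recurrence[OF assms(2)])
    also have "\<dots> = fact m * free_prob p m" using m by (simp add: fact_reduce[of m])
    finally show ?thesis by (simp add: m_def)
  qed
qed

section \<open>Lower bounds for the probability of having no such cycle\<close>

lemma factor_nonneg: "0 \<le> 1 - 1 / real k"
  by (cases "k = 0") (auto simp: divide_le_eq_1)

lemma free_prob_nonneg: "free_prob p m \<ge> 0"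
  unfolding free_prob_def by (intro prod_nonneg ballI factor_nonneg)

text \<open>
  Bernoulli's inequality gives \<open>(1 - 1 / (i * p)) ^ p \<ge> 1 - 1 / i\<close>, and the product of the right-hand
  sides over \<open>i = 2..M\<close> telescopes to \<open>1 / M\<close>. The factor \<open>i = 1\<close> is kept as it is, because there this
  estimate would be \<open>0\<close>. For \<open>m < p\<close> the product is empty, and the left-hand side is \<open>0\<close>.
\<close>

lemma free_prob_power_ge:
  assumes "p > 0"
  shows "real (m div p) * free_prob p m ^ p \<ge> (if p \<le> m then (1 - 1 / p) ^ p else 0)"
proof -
  have "real (Suc M) * (\<Prod>i = 1..Suc M. 1 - 1 / real (i * p)) ^ p \<ge> (1 - 1 / p) ^ p" for M
  proof (induction M)
    case (Suc M)
    let ?P = "(\<Prod>i = 1..Suc M. 1 - 1 / real (i * p)) ^ p"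
    define c where "c = real (Suc (Suc M))"
    have c: "c \<ge> 2" by (simp add: c_def)
    have cp: "c * p \<ge> 1 * 1" using c assms by (intro mult_mono) auto
    have "1 + real p * (- (1 / (c * p))) \<le> (1 + (- (1 / (c * p)))) ^ p"
      using cp by (intro Bernoulli_inequality) (simp add: divide_le_eq_1)
    then have "1 - 1 / c \<le> (1 - 1 / (c * p)) ^ p"
      using assms by simp
    then have "c * ?P * (1 - 1 / c) \<le> c * ?P * (1 - 1 / (c * p)) ^ p"
      using c by (intro mult_left_mono mult_nonneg_nonneg zero_le_power prod_nonneg ballI factor_nonneg) auto
    moreover have "c * ?P * (1 - 1 / c) = real (Suc M) * ?P"
      using c by (simp add: field_simps c_def)
    moreover have "c * ?P * (1 - 1 / (c * p)) ^ p =
        c * (\<Prod>i = 1..Suc (Suc M). 1 - 1 / real (i * p)) ^ p"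
      by (simp add: c_def power_mult_distrib mult_ac)
    ultimately show ?case using Suc.IH unfolding c_def by linarith
  qed simp
  note bound = this
  show ?thesis
  proof (cases "p \<le> m")
    case True
    then obtain M where "m div p = Suc M"
      using assms by (metis div_greater_zero_iff gr0_implies_Suc)
    then show ?thesis using bound[of M] True unfolding free_prob_def by simp
  qed simp
qed

text \<open>
  The bound in \<open>free_prob_power_ge\<close> amounts to about \<open>(n / p) powr (- 1 / p)\<close>, and \<open>n \<le> exp p\<close> turns this into
  \<open>p powr (1 / p) / exp 1\<close>. The spare factor \<open>p powr (1 / p)\<close> absorbs \<open>1 - 1 / p\<close> once \<open>p \<ge> 6\<close>.
\<close>

lemma free_prob_ge_inverse_exp:
  assumes p: "p \<ge> 6" and n: "ln n \<le> p" "p \<le> n"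
  shows "free_prob p (n - p) \<ge> 1 / exp 1"
proof (cases "p \<le> n - p")
  case False
  then show ?thesis using p by (simp add: free_prob_def)
next
  case True
  define M where "M = (n - p) div p"
  have M: "M > 0" using True p by (simp add: M_def div_greater_zero_iff)
  have "real M * p \<le> n"
    using div_times_less_eq_dividend[of "n - p" p] unfolding M_def of_nat_mult[symmetric] of_nat_le_iff
    by linarith
  also have "real n \<le> exp p" using n p by (metis exp_le_cancel_iff exp_ln of_nat_0_less_iff le_trans less_le_trans zero_less_numeral)
  finally have Mp: "real M * p \<le> exp p" .
  have "(p / (real p - 1)) ^ p \<le> exp (1 / (real p - 1)) ^ p"
  proof (rule power_mono)
    have "p / (real p - 1) = 1 + 1 / (real p - 1)" using p by (simp add: field_simps)
    also have "\<dots> \<le> exp (1 / (real p - 1))" by (rule exp_ge_add_one_self)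
    finally show "p / (real p - 1) \<le> exp (1 / (real p - 1))" .
  qed (use p in auto)
  also have "\<dots> = exp (p / (real p - 1))"
    by (simp add: exp_of_nat_mult[symmetric])
  also have "\<dots> \<le> exp (6 / 5)" using p by (simp add: field_simps)
  also have "\<dots> \<le> 6"
  proof (rule power_le_imp_le_base)
    have "exp (6 / 5 :: real) ^ Suc 4 = exp 1 ^ 6"
      by (simp add: exp_of_nat_mult[symmetric] del: power_Suc)
    also have "\<dots> \<le> (272 / 100 :: real) ^ 6"
      using e_less_272 by (intro power_mono) auto
    also have "\<dots> \<le> 6 ^ Suc 4" by (simp add: power_divide)
    finally show "exp (6 / 5 :: real) ^ Suc 4 \<le> 6 ^ Suc 4" .
  qed simp
  also have "(6::real) \<le> p" using p by simp
  finally have "(p / (real p - 1)) ^ p \<le> p" .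
  then have "1 \<le> p * ((real p - 1) / p) ^ p"
    using p by (simp add: power_divide field_simps)
  then have *: "1 \<le> p * (1 - 1 / p) ^ p" using p by (simp add: diff_divide_distrib)
  have "real M * 1 \<le> real M * (p * (1 - 1 / p) ^ p)"
    using * by (intro mult_left_mono) auto
  also have "\<dots> = (real M * p) * (1 - 1 / p) ^ p" by simp
  also have "\<dots> \<le> exp p * (1 - 1 / p) ^ p" using Mp p by (intro mult_right_mono) auto
  also have "\<dots> \<le> exp p * (real M * free_prob p (n - p) ^ p)"
    using free_prob_power_ge[of p "n - p"] p True by (intro mult_left_mono) (auto simp: M_def)
  finally have "1 \<le> exp p * free_prob p (n - p) ^ p" using M by simp
  then have "1 ^ Suc (p - 1) \<le> (exp 1 * free_prob p (n - p)) ^ Suc (p - 1)"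
    using p by (simp add: power_mult_distrib exp_of_nat_mult[symmetric] flip: power_Suc)
  then have "1 \<le> exp 1 * free_prob p (n - p)"
    by (rule power_le_imp_le_base) (simp add: free_prob_nonneg)
  then show ?thesis by (simp add: field_simps)
qed

text \<open>
  The constants are chosen for the proportion \<open>1 / 19\<close>: the range of \<open>n\<close> means \<open>(n - 3) div 3 \<le> 75\<close>, and
  \<open>(2 / 3) ^ 3 / 75\<close> barely exceeds \<open>(3 / 19) ^ 3\<close>.
\<close>

lemma free_prob_3_ge:
  assumes "n \<le> 230"
  shows "free_prob 3 (n - 3) \<ge> 3 / 19"
proof (cases "3 \<le> n - 3")
  case False
  then show ?thesis by (simp add: free_prob_def)
next
  case True
  have "(2 / 3) ^ 3 \<le> real ((n - 3) div 3) * free_prob 3 (n - 3) ^ 3"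
    using free_prob_power_ge[of 3 "n - 3"] True by simp
  also have "\<dots> \<le> 75 * free_prob 3 (n - 3) ^ 3"
    using assms free_prob_nonneg[of 3 "n - 3"] by (intro mult_right_mono) auto
  finally have "(3 / 19) ^ Suc 2 \<le> free_prob 3 (n - 3) ^ Suc 2"
    by (simp add: eval_nat_numeral)
  then show ?thesis by (rule power_le_imp_le_base) (rule free_prob_nonneg)
qed

section \<open>Permutations with a unique cycle of length divisible by a number\<close>

lemma fact_times_choose:
  assumes "0 < k" "k \<le> m"
  shows "real (m choose k) * (fact (k - 1) * fact (m - k)) = fact m / k"
proof -
  have "real (m choose k) * (fact (k - 1) * fact (m - k)) * k = real (fact k * fact (m - k) * (m choose k))"
    using assms by (simp add: fact_reduce[of k])
  also have "\<dots> = fact m" using assms by (simp only: binomial_fact_lemma of_nat_fact)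
  finally show ?thesis using assms by (simp add: field_simps)
qed

text \<open>
  A union bound over the possible cycles; the factor \<open>1 / k\<close> is the expected number of cycles of
  length \<open>k\<close>.
\<close>

lemma card_with_some_cycle_le:
  assumes "finite S" "0 < k"
  assumes "\<And>C. C \<subseteq> S \<Longrightarrow> card C = k \<Longrightarrow> B C \<subseteq> {b. b permutes (S - C)}"
  assumes "\<And>C. C \<subseteq> S \<Longrightarrow> card C = k \<Longrightarrow> real (card (B C)) \<le> fact (card S - k) * \<beta>" "\<beta> \<ge> 0"
  shows "real (card (\<Union>C\<in>{C. C \<subseteq> S \<and> card C = k}. with_cycle S C (B C))) \<le> fact (card S) / k * \<beta>"
proof (cases "k \<le> card S")
  case False
  then have "{C. C \<subseteq> S \<and> card C = k} = {}" using assms(1) card_mono by fastforce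
  then show ?thesis using assms by (simp only: ) simp
next
  case True
  let ?K = "{C. C \<subseteq> S \<and> card C = k}"
  have "real (card (\<Union>C\<in>?K. with_cycle S C (B C))) \<le> (\<Sum>C\<in>?K. real (card (with_cycle S C (B C))))"
    unfolding of_nat_sum[symmetric] of_nat_le_iff using assms(1) by (intro card_UN_le) simp
  also have "\<dots> \<le> (\<Sum>C\<in>?K. fact (k - 1) * (fact (card S - k) * \<beta>))"
  proof (rule sum_mono)
    fix C assume C: "C \<in> ?K"
    then have "C \<noteq> {}" using assms(2) by auto
    with C assms show "real (card (with_cycle S C (B C))) \<le> fact (k - 1) * (fact (card S - k) * \<beta>)"
      by (subst card_with_cycle) auto
  qed
  also have "\<dots> = real (card S choose k) * (fact (k - 1) * fact (card S - k)) * \<beta>"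
    using assms(1) by (simp add: n_subsets)
  also have "\<dots> = fact (card S) / k * \<beta>"
    using fact_times_choose[OF assms(2) True] by simp
  finally show ?thesis .
qed

text \<open>
  The permutations of \<open>S\<close> with exactly one cycle of length divisible by \<open>p\<close>, that cycle having length \<open>p\<close>.
  For a prime \<open>p\<close> these are the pre-\<open>p\<close>-cycles.
\<close>

definition unique_cycle_perms :: "nat \<Rightarrow> 'a set \<Rightarrow> ('a \<Rightarrow> 'a) set" where
  "unique_cycle_perms p S =
     (\<Union>C\<in>{C. C \<subseteq> S \<and> card C = p}. with_cycle S C (free_perms p (S - C)))"

lemma card_unique_cycle_perms:
  assumes "finite S" "0 < p" "p \<le> card S"
  shows "card (unique_cycle_perms p S) = fact (card S) / p * free_prob p (card S - p)"
proof -
  let ?K = "{C. C \<subseteq> S \<and> card C = p}"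
  have "with_cycle S C (free_perms p (S - C)) \<inter> with_cycle S D (free_perms p (S - D)) = {}"
    if CD: "C \<in> ?K" "D \<in> ?K" "C \<noteq> D" for C D
  proof (rule ccontr)
    assume "\<not> ?thesis"
    then obtain g where g: "cyclic_on g C" "cyclic_on g D" "\<forall>x\<in>S - C. \<not> p dvd card (orbit g x)"
      by (auto simp: with_cycle_free_perms_iff)
    then obtain x where x: "x \<in> D" using assms(2) CD by fastforce
    then have D: "orbit g x = D" using g(2) orbit_cyclic_eq3 by fast
    then have "x \<notin> C" using g(1) orbit_cyclic_eq3 CD by fast
    then have "x \<in> S - C" using x CD by auto
    with g(3) have "\<not> p dvd card D" using D by blast
    then show False using CD by simp
  qed
  then have "card (unique_cycle_perms p S) = (\<Sum>C\<in>?K. card (with_cycle S C (free_perms p (S - C))))"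
    unfolding unique_cycle_perms_def
    using assms(1) by (intro card_UN_disjoint ballI impI)
      (auto simp: with_cycle_def intro: finite_subset[OF _ finite_permutations[OF assms(1)]])
  also have "real \<dots> = (\<Sum>C\<in>?K. fact (p - 1) * (fact (card S - p) * free_prob p (card S - p)))"
    unfolding of_nat_sum
  proof (rule sum.cong)
    fix C assume C: "C \<in> ?K"
    then have "C \<noteq> {}" "finite C" "card (S - C) = card S - p"
      using assms by (auto simp: finite_subset card_Diff_subset)
    moreover have "free_perms p (S - C) \<subseteq> {b. b permutes (S - C)}"
      by (auto simp: free_perms_def)
    ultimately show "real (card (with_cycle S C (free_perms p (S - C)))) =
        fact (p - 1) * (fact (card S - p) * free_prob p (card S - p))"
      using C assms by (simp add: card_with_cycle card_free_perms)
  qed simp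
  also have "\<dots> = real (card S choose p) * (fact (p - 1) * fact (card S - p)) * free_prob p (card S - p)"
    using assms(1) by (simp add: n_subsets)
  also have "\<dots> = fact (card S) / p * free_prob p (card S - p)"
    using fact_times_choose[OF assms(2,3)] by simp
  finally show ?thesis .
qed

text \<open>
  A permutation in both sets has a cycle of length \<open>p\<close> and another one of length \<open>q\<close>, and the expected
  number of such pairs of cycles is at most \<open>1 / (p * q)\<close>.
\<close>

lemma card_two_cycle_lengths_le:
  assumes "finite S" "0 < p" "0 < q" "p \<noteq> q"
  shows "card (unique_cycle_perms p S \<inter> unique_cycle_perms q S) \<le> fact (card S) * (1 / p) * (1 / q)"
proof -
  define B where "B T = (\<Union>D\<in>{D. D \<subseteq> T \<and> card D = q}. with_cycle T D {b. b permutes (T - D)})"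
    for T :: "'a set"
  have B: "B T \<subseteq> {b. b permutes T}" for T by (auto simp: B_def with_cycle_def)
  have card_B: "real (card (B T)) \<le> fact (card T) * (1 / q)" if "finite T" for T
  proof -
    have "real (card (B T)) \<le> fact (card T) / q * 1"
      unfolding B_def using that assms(3)
      by (intro card_with_some_cycle_le) (auto simp: card_permutations card_Diff_subset finite_subset)
    then show ?thesis by simp
  qed
  have "unique_cycle_perms p S \<inter> unique_cycle_perms q S \<subseteq>
      (\<Union>C\<in>{C. C \<subseteq> S \<and> card C = p}. with_cycle S C (B (S - C)))"
  proof
    fix g assume "g \<in> unique_cycle_perms p S \<inter> unique_cycle_perms q S"
    then obtain C D where C: "C \<subseteq> S" "card C = p" "cyclic_on g C"
      and D: "D \<subseteq> S" "card D = q" "cyclic_on g D" and g: "g permutes S"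
      by (auto simp: unique_cycle_perms_def with_cycle_def)
    have "C \<inter> D = {}" using orbit_cyclic_eq3[OF C(3)] orbit_cyclic_eq3[OF D(3)] C(2) D(2) assms(4) by auto
    then have DC: "D \<subseteq> S - C" using D by auto
    let ?h = "perm_restrict g (S - C)"
    have h: "?h permutes (S - C)" using g C by (intro perm_restrict_diff_cyclic)
    have hD: "cyclic_on ?h D"
      using D(3) DC by (subst cyclic_cong[of _ _ g]) (auto simp: perm_restrict_simps)
    have "?h \<in> with_cycle (S - C) D {b. b permutes (S - C - D)}"
      using h hD perm_restrict_diff_cyclic[OF h hD] by (simp add: with_cycle_def)
    then have "?h \<in> B (S - C)" using DC D(2) by (auto simp: B_def)
    then show "g \<in> (\<Union>C\<in>{C. C \<subseteq> S \<and> card C = p}. with_cycle S C (B (S - C)))"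
      using g C by (auto simp: with_cycle_def)
  qed
  moreover have "finite (\<Union>C\<in>{C. C \<subseteq> S \<and> card C = p}. with_cycle S C (B (S - C)))"
    by (rule finite_subset[OF _ finite_permutations[OF assms(1)]]) (auto simp: with_cycle_def)
  ultimately have "real (card (unique_cycle_perms p S \<inter> unique_cycle_perms q S)) \<le>
      card (\<Union>C\<in>{C. C \<subseteq> S \<and> card C = p}. with_cycle S C (B (S - C)))"
    by (simp add: card_mono)
  also have "\<dots> \<le> fact (card S) / p * (1 / q)"
  proof (intro card_with_some_cycle_le)
    fix C assume "C \<subseteq> S" "card C = p"
    then show "real (card (B (S - C))) \<le> fact (card S - p) * (1 / q)"
      using card_B[of "S - C"] assms by (simp add: card_Diff_subset finite_subset)
  qed (use assms B in auto)
  finally show ?thesis by simp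
qed

lemma funpow_card_orbit:
  assumes "permutation g" "y \<in> orbit g x"
  shows "(g ^^ card (orbit g x)) y = y"
proof -
  have "cyclic_on g (orbit g x)" using assms(1) by (rule cyclic_on_orbit')
  then have eq: "orbit g x = orbit g y" using assms(2) orbit_cyclic_eq3 by fast
  have y: "y \<in> orbit g y" using assms(1) by (rule permutation_self_in_orbit)
  have "card (orbit g y) = funpow_dist1 g y y"
    using inj_on_funpow_dist1[OF y] by (subst orbit_conv_funpow_dist1[OF y]) (simp add: card_image)
  then show ?thesis using funpow_dist1_prop[OF y] by (simp add: eq)
qed

lemma orbit_funpow_coprime:
  assumes "permutation g" "coprime m (card (orbit g x))"
  shows "orbit (g ^^ m) x = orbit g x"
proof
  show "orbit (g ^^ m) x \<subseteq> orbit g x"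
  proof
    fix y assume "y \<in> orbit (g ^^ m) x"
    then obtain k where "y = (g ^^ (m * k)) x" by (auto simp: orbit_altdef funpow_mult mult.commute)
    then show "y \<in> orbit g x" using assms(1) by (auto simp: orbit_altdef_permutation)
  qed
  have perm: "permutation (g ^^ m)"
    by (induction m) (use assms(1) in \<open>auto simp only: funpow.simps permutation_id permutation_compose\<close>)
  let ?k = "card (orbit g x)"
  have fix_x: "(g ^^ ?k) x = x"
    using funpow_card_orbit[OF assms(1) permutation_self_in_orbit[OF assms(1)]] .
  have k: "?k > 0"
    using finite_orbit[OF permutation_self_in_orbit[OF assms(1)]] orbit_nonempty by (simp add: card_gt_0_iff)
  show "orbit g x \<subseteq> orbit (g ^^ m) x"
  proof
    fix y assume "y \<in> orbit g x"
    then obtain i where i: "y = (g ^^ i) x" using assms(1) by (auto simp: orbit_altdef_permutation)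
    obtain j where "[m * j = 1] (mod ?k)" using assms(2) cong_solve_coprime_nat[of m] by auto
    then have "[m * j * i = 1 * i] (mod ?k)" by (rule cong_scalar_right)
    then have "(g ^^ (m * (j * i))) x = (g ^^ i) x"
      using fix_x by (metis cong_def funpow_mod_eq mult.assoc mult_1)
    then have "y = ((g ^^ m) ^^ (j * i)) x" using i by (simp add: funpow_mult mult.commute)
    then show "y \<in> orbit (g ^^ m) x" using perm by (auto simp: orbit_altdef_permutation)
  qed
qed

lemma sym_group_pow: "g [^]\<^bsub>sym_group n\<^esub> (m::nat) = g ^^ m"
proof (induction m)
  case (Suc m)
  then show ?case by (simp add: sym_group_mult funpow_swap1 fun_eq_iff nat_pow_def)
qed (simp add: sym_group_one nat_pow_def)

text \<open>
  Raising to the product \<open>m\<close> of the other cycle lengths kills all other cycles. As \<open>p\<close> does not divide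
  \<open>m\<close>, the cycle of length \<open>p\<close> survives.
\<close>

lemma unique_cycle_perms_pre_cycle:
  assumes p: "prime p" and g: "g \<in> unique_cycle_perms p {1..n}"
  shows "is_pre_k_cycle n p g"
proof -
  obtain C where C: "C \<subseteq> {1..n}" "card C = p" "cyclic_on g C" and perm: "g permutes {1..n}"
    and free: "\<And>x. x \<in> {1..n} - C \<Longrightarrow> \<not> p dvd card (orbit g x)"
    using g by (auto simp: unique_cycle_perms_def with_cycle_free_perms_iff)
  have perm': "permutation g" using perm permutation_permutes finite_atLeastAtMost by blast
  \<comment> \<open>Each cycle contributes once per point, which does not affect divisibility by the prime \<open>p\<close>.\<close>
  define m where "m = (\<Prod>x\<in>{1..n} - C. card (orbit g x))"
  have pm: "\<not> p dvd m"
    unfolding m_def using free p by (subst prime_dvd_prod_iff) auto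
  have orbit_C: "orbit (g ^^ m) x = C" if "x \<in> C" for x
  proof -
    have "orbit g x = C" using C(3) that by (rule orbit_cyclic_eq3)
    moreover have "coprime m p" using pm p by (metis coprime_commute prime_imp_coprime)
    ultimately show ?thesis using orbit_funpow_coprime[OF perm', of m x] C(2) by simp
  qed
  have orbit_not_C: "orbit (g ^^ m) x = {x}" if x: "x \<in> {1..n} - C" for x
  proof -
    have "card (orbit g x) dvd m" unfolding m_def using x by (intro dvd_prodI) auto
    then obtain l where "m = card (orbit g x) * l" by auto
    then have "m mod card (orbit g x) = 0" by simp
    then have "(g ^^ m) x = x"
      using funpow_card_orbit[OF perm' permutation_self_in_orbit[OF perm'], of x]
      by (metis funpow_0 funpow_mod_eq)
    then show ?thesis by (simp add: orbit_eq_singleton_iff)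
  qed
  have p1: "1 < p" using p by (rule prime_gt_1_nat)
  then obtain x where x: "x \<in> C" using C(2) by fastforce
  have "{D \<in> perm_cycles n (g ^^ m). 1 < card D} = {C}"
  proof (intro equalityI subsetI)
    fix D assume "D \<in> {D \<in> perm_cycles n (g ^^ m). 1 < card D}"
    then obtain y where y: "y \<in> {1..n}" "D = orbit (g ^^ m) y" "1 < card D"
      by (auto simp: perm_cycles_def)
    then have "y \<in> C" using orbit_not_C[of y] by (cases "y \<in> C") auto
    then show "D \<in> {C}" using y orbit_C by simp
  next
    fix D assume "D \<in> {C}"
    then show "D \<in> {D \<in> perm_cycles n (g ^^ m). 1 < card D}"
      using x C p1 orbit_C[OF x] by (auto simp: perm_cycles_def)
  qed
  moreover have "g ^^ m permutes {1..n}"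
    using perm by (rule permutes_funpow)
  ultimately have "is_k_cycle n p (g ^^ m)"
    using C p1 by (auto simp: is_k_cycle_def sym_group_carrier)
  then show ?thesis
    using p1 perm by (auto simp: is_pre_k_cycle_def sym_group_carrier sym_group_pow)
qed

section \<open>Sums over primes\<close>

text \<open>
  A form of Legendre's formula: the multiples of \<open>p\<close> up to \<open>n\<close> contribute \<open>q + multiplicity p (fact q)\<close>
  with \<open>q = n div p\<close>.
\<close>

lemma multiplicity_fact_le:
  assumes p: "prime (p::nat)"
  shows "(p - 1) * multiplicity p (fact n) \<le> n"
proof (induction n rule: less_induct)
  case (less n)
  have p1: "p > 1" using p prime_gt_1_nat by blast
  show ?case
  proof (cases "n = 0")
    case False
    let ?q = "n div p"
    have mult: "multiplicity p (fact m) = (\<Sum>k\<in>{1..m}. multiplicity p k)" for m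
      using p by (simp add: fact_prod prime_elem_multiplicity_prod_distrib)
    have "(\<Sum>k\<in>{1..n}. multiplicity p k) = (\<Sum>k\<in>(*) p ` {1..?q}. multiplicity p k)"
    proof (rule sum.mono_neutral_right)
      show "(*) p ` {1..?q} \<subseteq> {1..n}"
        using p1 by (auto simp: less_eq_div_iff_mult_less_eq mult.commute)
      show "\<forall>k\<in>{1..n} - (*) p ` {1..?q}. multiplicity p k = 0"
      proof
        fix k assume k: "k \<in> {1..n} - (*) p ` {1..?q}"
        have "\<not> p dvd k"
        proof
          assume "p dvd k"
          then obtain j where j: "k = p * j" by auto
          then have "j \<in> {1..?q}"
            using k p1 by (auto simp: less_eq_div_iff_mult_less_eq mult.commute)
          then show False using k j by auto
        qed
        then show "multiplicity p k = 0" by (rule not_dvd_imp_multiplicity_0)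
      qed
    qed simp
    also have "\<dots> = (\<Sum>j\<in>{1..?q}. multiplicity p (p * j))"
      using p1 by (subst sum.reindex) (auto simp: inj_on_def)
    also have "\<dots> = (\<Sum>j\<in>{1..?q}. Suc (multiplicity p j))"
      using p p1 by (intro sum.cong) (auto simp: multiplicity_times_same)
    also have "\<dots> = ?q + multiplicity p (fact ?q)"
      unfolding mult sum_Suc by simp
    finally have "(p - 1) * multiplicity p (fact n) = (p - 1) * ?q + (p - 1) * multiplicity p (fact ?q)"
      by (simp only: mult distrib_left)
    also have "\<dots> \<le> (p - 1) * ?q + ?q"
      using less.IH[of ?q] False p1 by simp
    also have "\<dots> = p * ?q" using p1 by (cases p) auto
    also have "\<dots> \<le> n" by simp
    finally show ?thesis .
  qed simp
qed

text \<open>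
  The lower half of Mertens' first theorem: compare the prime factorization of \<open>fact n\<close> with Stirling's
  lower bound \<open>fact n \<ge> (n / exp 1) ^ n\<close>.
\<close>

lemma sum_ln_over_primes_ge:
  fixes n :: nat
  assumes "n > 0"
  shows "ln n - 1 \<le> (\<Sum>p | prime p \<and> p \<le> n. ln p / (real p - 1))"
proof -
  have "real n ^ n \<le> exp n * fact n"
  proof -
    \<comment> \<open>A single term of the exponential series.\<close>
    have "real n ^ n / fact n \<le> exp (real n)"
      using sum_le_suminf[OF summable_exp_generic[of "real n"], of "{n}"]
      by (simp add: exp_def field_simps)
    then show ?thesis by (simp add: field_simps)
  qed
  then have "ln (real n ^ n) \<le> ln (exp n * fact n)" using assms by (intro ln_mono) auto
  then have "n * (ln n - 1) \<le> ln (fact n :: real)"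
    using assms by (simp add: ln_mult ln_realpow algebra_simps)
  also have "(fact n :: real) = real (\<Prod>p | prime p \<and> p \<le> n. p ^ multiplicity p (fact n :: nat))"
  proof -
    have "fact n = (\<Prod>p\<in>prime_factors (fact n). p ^ multiplicity p (fact n :: nat))"
      using prime_factorization_nat[of "fact n"] by simp
    also have "prime_factors (fact n :: nat) = {p. prime p \<and> p \<le> n}"
      by (auto simp: prime_factors_dvd prime_dvd_fact_iff)
    finally show ?thesis by (metis of_nat_fact)
  qed
  also have "ln \<dots> = (\<Sum>p | prime p \<and> p \<le> n. multiplicity p (fact n :: nat) * ln p)"
    unfolding of_nat_prod by (subst ln_prod) (auto simp: ln_realpow prime_gt_0_nat)
  also have "\<dots> \<le> (\<Sum>p | prime p \<and> p \<le> n. n * (ln p / (real p - 1)))"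
  proof (rule sum_mono)
    fix p assume "p \<in> {p. prime p \<and> p \<le> n}"
    then have p: "prime p" "p > 1" by (auto dest: prime_gt_1_nat)
    have "real ((p - 1) * multiplicity p (fact n :: nat)) \<le> n"
      using multiplicity_fact_le[OF p(1)] of_nat_le_iff by blast
    then have "real (multiplicity p (fact n :: nat)) \<le> n / (real p - 1)"
      using p by (simp add: field_simps of_nat_diff)
    then have "multiplicity p (fact n :: nat) * ln p \<le> n / (real p - 1) * ln p"
      using p by (intro mult_right_mono) auto
    then show "multiplicity p (fact n :: nat) * ln p \<le> n * (ln p / (real p - 1))" by simp
  qed
  also have "\<dots> = n * (\<Sum>p | prime p \<and> p \<le> n. ln p / (real p - 1))"
    by (simp add: sum_distrib_left)
  finally show ?thesis using assms by simp
qed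

lemma ln_le_minus_one_times_ln2:
  assumes "k > 0"
  shows "ln (real k) \<le> (real k - 1) * ln 2"
proof -
  have "k \<le> 2 ^ (k - 1)"
    using less_exp[of "k - 1"] assms by (cases k) (simp_all add: Suc_le_eq)
  then have "real k \<le> real (2 ^ (k - 1))" by (rule of_nat_mono)
  then have "ln (real k) \<le> ln (2 ^ (k - 1))" using assms by simp
  then show ?thesis using assms by (simp add: ln_realpow of_nat_diff)
qed

lemma ln_229_ge: "ln 229 \<ge> (27 / 5 :: real)"
proof -
  have "exp (27 / 5 :: real) \<le> 229"
  proof (rule power_le_imp_le_base)
    have "exp (27 / 5 :: real) ^ Suc 4 = exp 1 ^ 27"
      by (simp add: exp_of_nat_mult[symmetric] del: power_Suc)
    also have "\<dots> \<le> (272 / 100 :: real) ^ 27"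
      using e_less_272 by (intro power_mono) auto
    also have "\<dots> \<le> 229 ^ Suc 4" by (simp add: power_divide)
    finally show "exp (27 / 5 :: real) ^ Suc 4 \<le> 229 ^ Suc 4" .
  qed simp
  then show ?thesis by (subst ln_ge_iff) auto
qed

text \<open>
  In the sum of \<open>ln p / (p - 1)\<close> over all primes up to \<open>n - 3\<close>, which is about \<open>ln n\<close>, the primes below
  \<open>L = ln n\<close> number at most \<open>L - 1\<close> and contribute at most \<open>ln 2\<close> each. So a fixed proportion of \<open>ln n\<close> is
  left for the primes from \<open>L\<close> on, and \<open>ln p \<le> ln n\<close> converts it into a bound for the sum of \<open>1 / p\<close>.
  The value \<open>229\<close> makes \<open>L \<ge> 27 / 5\<close>, which is just enough for \<open>1 / 5\<close>.
\<close>

lemma sum_inverse_primes_ge: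
  fixes n :: nat
  assumes n: "n \<ge> 229"
  shows "1 / 5 \<le> (\<Sum>p | prime p \<and> ln n \<le> p \<and> p \<le> n - 3. 1 / real p)"
proof -
  define L where "L = ln (real n)"
  have "ln 229 \<le> L" unfolding L_def using n by (intro ln_mono) auto
  then have L: "L \<ge> 27 / 5" using ln_229_ge by linarith
  let ?f = "\<lambda>p::nat. ln p / (real p - 1)"
  let ?P = "{p. prime p \<and> L \<le> p \<and> p \<le> n - 3}"
  let ?Q = "{p::nat. prime p \<and> p < L}"
  have finQ: "finite ?Q"
    by (rule finite_subset[of _ "{..nat \<lfloor>L\<rfloor>}"]) (auto simp: le_nat_floor)
  have f_le: "?f p \<le> ln 2" if "prime p" for p
    using ln_le_minus_one_times_ln2[of p] prime_gt_1_nat[OF that] by (simp add: divide_le_eq mult.commute)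
  have f_nonneg: "?f p \<ge> 0" if "prime p" for p
    using prime_gt_1_nat[OF that] by simp
  have Q: "real (card ?Q) \<le> L - 1"
  proof -
    have "?Q \<subseteq> {2..nat \<lfloor>L\<rfloor>}" by (auto simp: le_nat_floor prime_ge_2_nat)
    then have "card ?Q \<le> card {2..nat \<lfloor>L\<rfloor>}" by (intro card_mono) auto
    then have "card ?Q \<le> nat \<lfloor>L\<rfloor> - 1" by simp
    moreover have "real (nat \<lfloor>L\<rfloor> - 1) \<le> L - 1" using L by linarith
    ultimately show ?thesis by linarith
  qed
  \<comment> \<open>The loss from replacing \<open>n\<close> by \<open>n - 3\<close>.\<close>
  have "ln (229 / 226) + ln (n - 3) \<ge> L"
  proof -
    have "ln (real n) \<le> ln (229 / 226 * real (n - 3))" using n by (intro ln_mono) auto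
    also have "\<dots> = ln (229 / 226) + ln (real (n - 3))" using n by (intro ln_mult_pos) auto
    finally show ?thesis by (simp only: L_def)
  qed
  moreover have "ln (229 / 226 :: real) \<le> 229 / 226 - 1" by (rule ln_le_minus_one) simp
  ultimately have "L - 3 / 226 - 1 \<le> (\<Sum>p | prime p \<and> p \<le> n - 3. ?f p)"
    using sum_ln_over_primes_ge[of "n - 3"] n by simp
  also have "\<dots> \<le> (\<Sum>p\<in>?Q \<union> ?P. ?f p)"
    using finQ by (intro sum_mono2) (auto simp: f_nonneg)
  also have "\<dots> = (\<Sum>p\<in>?Q. ?f p) + (\<Sum>p\<in>?P. ?f p)"
    using finQ by (intro sum.union_disjoint) auto
  also have "(\<Sum>p\<in>?Q. ?f p) \<le> card ?Q * (25 / 36)"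
    by (intro sum_bounded_above order_trans[OF f_le ln2_le_25_over_36]) simp
  also have "\<dots> \<le> (L - 1) * (25 / 36)" using Q by (intro mult_right_mono) auto
  also have "(\<Sum>p\<in>?P. ?f p) \<le> (\<Sum>p\<in>?P. 6 / 5 * L * (1 / p))"
  proof (rule sum_mono)
    fix p assume p: "p \<in> ?P"
    then have "27 / 5 \<le> real p" using L by auto
    then have p6: "p \<ge> 6" by linarith
    have "ln p \<le> L" unfolding L_def using p p6 by (intro ln_mono) auto
    then have "?f p \<le> L / (real p - 1)" using p6 by (intro divide_right_mono) auto
    also have "\<dots> \<le> 6 / 5 * L * (1 / p)"
      using p6 L by (simp add: field_simps)
    finally show "?f p \<le> 6 / 5 * L * (1 / p)" .
  qed
  also have "\<dots> = 6 / 5 * L * (\<Sum>p\<in>?P. 1 / p)" by (simp only: sum_distrib_left)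
  finally have "L - 3 / 226 - 1 \<le> (L - 1) * (25 / 36) + 6 / 5 * L * (\<Sum>p\<in>?P. 1 / p)" by simp
  moreover have "6 / 5 * L * (1 / 5) \<le> L - 3 / 226 - 1 - (L - 1) * (25 / 36)"
    using L by (simp add: field_simps)
  ultimately have "6 / 5 * L * (1 / 5) \<le> 6 / 5 * L * (\<Sum>p\<in>?P. 1 / p)" by linarith
  then have "1 / 5 \<le> (\<Sum>p\<in>?P. 1 / p)" using L by (subst (asm) mult_le_cancel_left_pos) auto
  then show ?thesis by (simp add: L_def)
qed

section \<open>Unions of events with small intersections\<close>

text \<open>
  The quadratic lower bound in \<open>card_Union_ge\<close> deteriorates when too many primes are used, so the set of
  primes has to be thinned out.
\<close>

lemma subset_sum_in_window:
  fixes w :: "'a \<Rightarrow> real"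
  assumes "finite S" "\<And>i. i \<in> S \<Longrightarrow> w i \<le> \<delta>" "0 \<le> a" "0 \<le> \<delta>" "a \<le> sum w S"
  shows "\<exists>T\<subseteq>S. a \<le> sum w T \<and> sum w T \<le> a + \<delta>"
  using assms
proof (induction S rule: finite_induct)
  case empty
  then show ?case by auto
next
  case (insert i S)
  show ?case
  proof (cases "a \<le> sum w S")
    case True
    then show ?thesis using insert by (meson insertCI subset_insertI2)
  next
    case False
    then show ?thesis using insert by (intro exI[of _ "insert i S"]) fastforce
  qed
qed

text \<open>
  A Bonferroni inequality, with \<open>N\<close> the size of the probability space. A new event \<open>A i\<close> adds at least
  \<open>s * w i\<close> and overlaps the earlier ones in at most \<open>w i * sum w I\<close>, no more than the growth of
  \<open>(sum w I)\<^sup>2 / 2\<close>.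
\<close>

lemma card_Union_ge:
  fixes w :: "'i \<Rightarrow> real" and A :: "'i \<Rightarrow> 'a set"
  assumes "finite I" "\<And>i. i \<in> I \<Longrightarrow> finite (A i)" "N \<ge> 0"
  assumes "\<And>i. i \<in> I \<Longrightarrow> N * s * w i \<le> card (A i)"
  assumes "\<And>i j. i \<in> I \<Longrightarrow> j \<in> I \<Longrightarrow> i \<noteq> j \<Longrightarrow> card (A i \<inter> A j) \<le> N * w i * w j"
  shows "N * (s * sum w I - (sum w I)\<^sup>2 / 2) \<le> card (\<Union>i\<in>I. A i)"
  using assms(1,2,4,5)
proof (induction I rule: finite_induct)
  case empty
  then show ?case by simp
next
  case (insert i I)
  let ?U = "\<Union>j\<in>I. A j"
  have "card (A i \<inter> ?U) \<le> (\<Sum>j\<in>I. card (A i \<inter> A j))"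
    unfolding Int_UN_distrib using insert.hyps(1) by (rule card_UN_le)
  then have "real (card (A i \<inter> ?U)) \<le> (\<Sum>j\<in>I. real (card (A i \<inter> A j)))"
    by (metis of_nat_le_iff of_nat_sum)
  also have "\<dots> \<le> (\<Sum>j\<in>I. N * w i * w j)"
    using insert.hyps insert.prems(3) by (intro sum_mono) auto
  also have "\<dots> = N * w i * sum w I" by (simp add: sum_distrib_left)
  finally have inter: "real (card (A i \<inter> ?U)) \<le> N * w i * sum w I" .
  have "card (A i) + card ?U = card (A i \<union> ?U) + card (A i \<inter> ?U)"
    using insert.hyps insert.prems(1) by (intro card_Un_Int) auto
  then have "real (card (A i)) + card ?U = real (card (A i \<union> ?U)) + card (A i \<inter> ?U)"
    by (metis of_nat_add)
  moreover have "N * (s * sum w I - (sum w I)\<^sup>2 / 2) \<le> card ?U"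
    using insert.prems by (intro insert.IH) auto
  moreover have "N * s * w i \<le> card (A i)" using insert.prems by auto
  moreover have "N * (s * sum w (insert i I) - (sum w (insert i I))\<^sup>2 / 2) =
      N * (s * sum w I - (sum w I)\<^sup>2 / 2) + N * s * w i - N * w i * sum w I - N * (w i)\<^sup>2 / 2"
    unfolding sum.insert[OF insert.hyps] by (simp only: power2_eq_square) algebra
  moreover have "0 \<le> N * (w i)\<^sup>2 / 2" using assms(3) by simp
  moreover have "card (\<Union>j\<in>insert i I. A j) = card (A i \<union> ?U)" by simp
  ultimately show ?case using inter by linarith
qed

section \<open>The proportion of pre-cycles of prime length\<close>

lemma sym_proportion_ge_Union:
  assumes "\<And>p. p \<in> I \<Longrightarrow> prime p \<and> p \<le> n - 3"
  shows "card (\<Union>p\<in>I. unique_cycle_perms p {1..n}) / fact n \<le> sym_proportion n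
           (\<lambda>g. \<exists>p::nat. prime p \<and> 2 \<le> p \<and> p \<le> n - 3 \<and> is_pre_k_cycle n p g)"
proof -
  let ?X = "{g \<in> carrier (sym_group n).
    \<exists>p::nat. prime p \<and> 2 \<le> p \<and> p \<le> n - 3 \<and> is_pre_k_cycle n p g}"
  have "(\<Union>p\<in>I. unique_cycle_perms p {1..n}) \<subseteq> ?X"
  proof
    fix g assume "g \<in> (\<Union>p\<in>I. unique_cycle_perms p {1..n})"
    then obtain p where p: "p \<in> I" "g \<in> unique_cycle_perms p {1..n}" by blast
    then have "prime p" "p \<le> n - 3" using assms by auto
    moreover have "is_pre_k_cycle n p g"
      using \<open>prime p\<close> p(2) by (rule unique_cycle_perms_pre_cycle)
    ultimately show "g \<in> ?X" using prime_ge_2_nat by (auto simp: is_pre_k_cycle_def)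
  qed
  moreover have "finite ?X"
    by (rule finite_subset[OF _ finite_permutations[of "{1..n}"]]) (auto simp: sym_group_carrier)
  ultimately show ?thesis
    unfolding sym_proportion_def by (intro divide_right_mono) (auto intro: card_mono)
qed

lemma sym_proportion_ge_single:
  assumes "prime p" "p \<le> n - 3"
  shows "free_prob p (n - p) / p \<le> sym_proportion n
           (\<lambda>g. \<exists>p::nat. prime p \<and> 2 \<le> p \<and> p \<le> n - 3 \<and> is_pre_k_cycle n p g)"
proof -
  have "card (unique_cycle_perms p {1..n}) = fact n / p * free_prob p (n - p)"
    using card_unique_cycle_perms[of "{1..n}" p] assms by (simp add: prime_gt_0_nat)
  then show ?thesis using sym_proportion_ge_Union[of "{p}" n] assms by simp
qed

text \<open>
  With \<open>t\<close> the sum of \<open>1 / p\<close> over the chosen primes, the proportion is at least \<open>t / exp 1 - t\<^sup>2 / 2\<close>.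
  This is a concave function of \<open>t\<close> which exceeds \<open>1 / 19\<close> at both ends of the window from \<open>1 / 5\<close> to
  \<open>1 / 5 + 1 / 6\<close>; the width of the window is a bound for the single terms \<open>1 / p\<close>.
\<close>

lemma sym_proportion_ge_large:
  assumes n: "n \<ge> 229"
  shows "1 / 19 \<le> sym_proportion n
           (\<lambda>g. \<exists>p::nat. prime p \<and> 2 \<le> p \<and> p \<le> n - 3 \<and> is_pre_k_cycle n p g)"
proof -
  let ?P = "{p. prime p \<and> ln n \<le> p \<and> p \<le> n - 3}"
  have "ln 229 \<le> ln (real n)" using n by (intro ln_mono) auto
  then have ln_n: "27 / 5 \<le> ln (real n)" using ln_229_ge by linarith
  have p6: "p \<ge> 6" if "p \<in> ?P" for p
  proof -
    have "27 / 5 \<le> real p" using that ln_n by auto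
    then show ?thesis by linarith
  qed
  have "\<exists>I\<subseteq>?P. 1 / 5 \<le> (\<Sum>p\<in>I. 1 / real p) \<and> (\<Sum>p\<in>I. 1 / real p) \<le> 1 / 5 + 1 / 6"
  proof (rule subset_sum_in_window)
    show "finite ?P" by (rule finite_subset[of _ "{..n}"]) auto
    show "1 / real p \<le> 1 / 6" if "p \<in> ?P" for p
      using p6[OF that] by (simp add: field_simps)
  qed (use sum_inverse_primes_ge[OF n] in auto)
  then obtain I where I: "I \<subseteq> ?P" and sum_I: "1 / 5 \<le> (\<Sum>p\<in>I. 1 / real p)" "(\<Sum>p\<in>I. 1 / real p) \<le> 11 / 30"
    by auto
  have finI: "finite I" by (rule finite_subset[of _ "{..n}"]) (use I in auto)
  define t where "t = (\<Sum>p\<in>I. 1 / real p)"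
  have "fact n * (1 / exp 1 * t - t\<^sup>2 / 2) \<le> card (\<Union>p\<in>I. unique_cycle_perms p {1..n})"
    unfolding t_def
  proof (rule card_Union_ge)
    show "finite (unique_cycle_perms p {1..n})" for p
      by (rule finite_subset[OF _ finite_permutations[of "{1..n}"]])
        (auto simp: unique_cycle_perms_def with_cycle_def)
    show "fact n * (1 / exp 1) * (1 / real p) \<le> card (unique_cycle_perms p {1..n})" if "p \<in> I" for p
    proof -
      have p: "p \<ge> 6" "ln n \<le> p" "p \<le> n" using that I p6[of p] by auto
      have "fact n * (1 / exp 1) * (1 / real p) = fact n / p * (1 / exp 1)" by simp
      also have "\<dots> \<le> fact n / p * free_prob p (n - p)"
        using p by (intro mult_left_mono free_prob_ge_inverse_exp) auto
      also have "\<dots> = card (unique_cycle_perms p {1..n})"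
        using p by (subst card_unique_cycle_perms) auto
      finally show ?thesis .
    qed
    show "card (unique_cycle_perms p {1..n} \<inter> unique_cycle_perms q {1..n}) \<le> fact n * (1 / real p) * (1 / real q)"
      if "p \<in> I" "q \<in> I" "p \<noteq> q" for p q
    proof -
      have "p \<ge> 6" "q \<ge> 6" using that I p6 by blast+
      then show ?thesis using card_two_cycle_lengths_le[of "{1..n}" p q] that by simp
    qed
  qed (use finI in auto)
  then have "1 / exp 1 * t - t\<^sup>2 / 2 \<le> card (\<Union>p\<in>I. unique_cycle_perms p {1..n}) / fact n"
    by (simp add: field_simps)
  also have "\<dots> \<le> sym_proportion n
           (\<lambda>g. \<exists>p::nat. prime p \<and> 2 \<le> p \<and> p \<le> n - 3 \<and> is_pre_k_cycle n p g)"
    using I by (intro sym_proportion_ge_Union) auto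
  finally have bound: "1 / exp 1 * t - t\<^sup>2 / 2 \<le> \<dots>" .
  have "1 / 19 \<le> 100 / 272 * t - t\<^sup>2 / 2"
  proof -
    \<comment> \<open>On the window, \<open>t\<^sup>2\<close> lies below its chord.\<close>
    have "0 \<le> (t - 1 / 5) * (11 / 30 - t)" using sum_I unfolding t_def by (intro mult_nonneg_nonneg) auto
    then have "t\<^sup>2 \<le> 17 / 30 * t - 11 / 150" by (simp add: power2_eq_square field_simps)
    moreover have "1 / 5 \<le> t" using sum_I by (simp add: t_def)
    ultimately show ?thesis by linarith
  qed
  also have "100 / 272 * t \<le> 1 / exp 1 * t"
  proof (rule mult_right_mono)
    show "100 / 272 \<le> 1 / exp (1::real)" using e_less_272 by (simp add: field_simps)
    show "0 \<le> t" using sum_I by (simp add: t_def)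
  qed
  finally show ?thesis using bound by linarith
qed

theorem mainTheorem4:
  fixes n :: nat
  assumes "n \<ge> 5"
  shows "sym_proportion n
           (\<lambda>g. \<exists>p::nat. prime p \<and> 2 \<le> p \<and> p \<le> n - 3 \<and> is_pre_k_cycle n p g) \<ge> 1 / 19"
proof -
  consider "n = 5" | "6 \<le> n" "n \<le> 230" | "n \<ge> 229" using assms by linarith
  then show ?thesis
  proof cases
    case 1
    have "free_prob 2 3 = 1 / 2" by (simp add: free_prob_def)
    then show ?thesis using sym_proportion_ge_single[of 2 5] 1 by simp
  next
    case 2
    have "prime (3::nat)" by simp
    then have "free_prob 3 (n - 3) / 3 \<le> sym_proportion n
           (\<lambda>g. \<exists>p::nat. prime p \<and> 2 \<le> p \<and> p \<le> n - 3 \<and> is_pre_k_cycle n p g)"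
      using sym_proportion_ge_single[of 3 n] 2 by simp
    then show ?thesis using free_prob_3_ge[OF 2(2)] by linarith
  next
    case 3
    then show ?thesis by (rule sym_proportion_ge_large)
  qed
qed

end
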